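(* Let $X$ be a quasi-Banach function lattice over a metric measure space $(\mathcal P,d,\mu)$. Assume that $u_j\to u$ in $N^1X$ as $j\to\infty$ (i.e., $u_j,u\in N^1X$ and $\|u_j-u\|_{N^1X}\to0$). Then there is a subsequence which converges to $u$ pointwise q.e. Moreover, for every $\varepsilon>0$ there is a set $E\subset\mathcal P$ with $C_X(E)<\varepsilon$ such that the subsequence converges uniformly to $u$ outside of $E$. If all functions $u_j$ are continuous, then for every $\varepsilon>0$ there is an open set $G$ with $C_X(G)<\varepsilon$ such that the subsequence converges uniformly outside of $G$ (not necessarily to $u$, though).
   Context: Standing setting: $(\mathcal P,d)$ is a metric space with a $\sigma$-finite Borel regular measure $\mu$ (Borel sets are $\mu$-measurable, and each $\mu$-measurable set $A$ is contained in a Borel set $D$ with $\mu(D)=\mu(A)$), such that every ball has finite positive measure. $\mathcal M(\mathcal P,\mu)$ is the set of extended real-valued $\mu$-measurable functions on $\mathcal P$ (defined everywhere). A quasi-Banach function lattice $X$ is given by a functional $\|\cdot\|_X:\mathcal M(\mathcal P,\mu)\to[0,\infty]$ with $X=\{u\in\mathcal M(\mathcal P,\mu):\|u\|_X<\infty\}$ such that, for some constant $c\ge1$ (the modulus of concavity): (i) $\|u\|_X=0$ iff $u=0$ a.e.; $\|au\|_X=|a|\,\|u\|_X$ for $a\in\mathbb R$; $\|u+v\|_X\le c(\|u\|_X+\|v\|_X)$; (ii) $|u|\le|v|$ a.e. implies $\|u\|_X\le\|v\|_X$; (iii) (Riesz–Fischer) if $u_n\ge0$ a.e. for all $n\ge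 1$, then $\bigl\|\sum_{n=1}^\infty u_n\bigr\|_X\le\sum_{n=1}^\infty c^n\|u_n\|_X$. Moreover, $\|\cdot\|_X$ is assumed continuous: $\|u_n-u\|_X\to0$ implies $\|u_n\|_X\to\|u\|_X$. Elements of $X$ are functions defined everywhere, not a.e. equivalence classes. A curve is a non-constant rectifiable continuous map from a compact interval to $\mathcal P$, always parametrized by arc length, $\gamma:[0,l_\gamma]\to\mathcal P$. A Borel function $g:\mathcal P\to[0,\infty]$ is an upper gradient of $u:\mathcal P\to\overline{\mathbb R}=\mathbb{R}\cup\{\pm\infty\}$ if $|u(\gamma(0))-u(\gamma(l_\gamma))|\le\int_\gamma g\,ds$ for all curves $\gamma$, with the convention $|(\pm\infty)-(\pm\infty)|=\infty$ in this inequality. For $u\in\mathcal M(\mathcal P,\mu)$, $\|u\|_{N^1X}=\|u\|_X+\inf_g\|g\|_X$, the infimum being over all upper gradients $g$ of $u$; $N^1X=\{u\in\mathcal M(\mathcal P,\mu):\|u\|_{N^1X}<\infty\}$ (functions defined everywhere). When forming differences of functions pointwise, the value at points where the expression is of the form $\infty-\infty$ is taken to be $0$. The (Sobolev) $X$-capacity of $E\subset\mathcal P$ is $C_X(E)=\inf\{\|u\|_{N^1X}:u\ge1\text{ on }E\}$. A property holds q.e. (quasi-everywhere) if the set of exceptional points has $X$-capacity zero. *)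

theory Defs
  imports "HOL-Analysis.Analysis"
begin

text \<open>The measurable sets are the sets of \<open>M\<close>, which need not be complete.\<close>

locale metric_measure_space = sigma_finite_measure M
  for M :: "'a::metric_space measure" +
  assumes space_eq_UNIV: "space M = UNIV"
    and borel_subset: "sets borel \<subseteq> sets M"
    and borel_regular:
      "A \<in> sets M \<Longrightarrow> \<exists>D \<in> sets borel. A \<subseteq> D \<and> emeasure M D = emeasure M A"
    and ball_pos: "0 < r \<Longrightarrow> 0 < emeasure M (ball x r)"
    and ball_finite: "emeasure M (ball x r) < \<infinity>"

text \<open>
  Sums and differences with the convention \<open>\<infinity> - \<infinity> = 0\<close>. The library operations on
  \<^typ>\<open>ereal\<close> yield \<open>\<infinity>\<close> there instead.
\<close>

definition ext_add :: "ereal \<Rightarrow> ereal \<Rightarrow> ereal" where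
  "ext_add x y = (if \<bar>x\<bar> = \<infinity> \<and> y = - x then 0 else x + y)"

definition ext_diff :: "ereal \<Rightarrow> ereal \<Rightarrow> ereal" where
  "ext_diff x y = ext_add x (- y)"

text \<open>
  \<open>N\<close> is the functional \<open>\<parallel>\<cdot>\<parallel>\<^sub>X\<close> and \<open>c\<close> its modulus of concavity. Only the values of \<open>N\<close> on
  measurable functions are constrained. In \<open>riesz_fischer\<close>, the sequence
  is indexed from 0, whence the exponent \<open>Suc n\<close>; since the terms are only nonnegative almost
  everywhere, the sum is a measurable function \<open>s\<close> determined only almost everywhere.
\<close>

locale quasi_Banach_function_lattice = metric_measure_space M
  for M :: "'a::metric_space measure" +
  fixes c :: real
    and N :: "('a \<Rightarrow> ereal) \<Rightarrow> ennreal"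
  assumes modulus_ge_1: "1 \<le> c"
    and norm_eq_0_iff: "u \<in> borel_measurable M \<Longrightarrow> N u = 0 \<longleftrightarrow> (AE x in M. u x = 0)"
    and norm_scale:
      "u \<in> borel_measurable M \<Longrightarrow> N (\<lambda>x. ereal a * u x) = ennreal \<bar>a\<bar> * N u"
    and norm_quasi_triangle:
      "\<lbrakk>u \<in> borel_measurable M; v \<in> borel_measurable M\<rbrakk>
        \<Longrightarrow> N (\<lambda>x. ext_add (u x) (v x)) \<le> ennreal c * (N u + N v)"
    and norm_mono:
      "\<lbrakk>u \<in> borel_measurable M; v \<in> borel_measurable M; AE x in M. \<bar>u x\<bar> \<le> \<bar>v x\<bar>\<rbrakk>
        \<Longrightarrow> N u \<le> N v"
    and riesz_fischer:
      "\<lbrakk>\<And>n. w n \<in> borel_measurable M; \<And>n. AE x in M. 0 \<le> w n x;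
        s \<in> borel_measurable M; AE x in M. (\<lambda>n. w n x) sums s x\<rbrakk>
        \<Longrightarrow> N s \<le> (\<Sum>n. ennreal (c ^ Suc n) * N (w n))"
    and norm_continuous:
      "\<lbrakk>\<And>n. w n \<in> borel_measurable M; u \<in> borel_measurable M;
        (\<lambda>n. N (\<lambda>x. ext_diff (w n x) (u x))) \<longlonglongrightarrow> 0\<rbrakk>
        \<Longrightarrow> (\<lambda>n. N (w n)) \<longlonglongrightarrow> N u"

definition curve_length :: "(real \<Rightarrow> 'a::metric_space) \<Rightarrow> real \<Rightarrow> real \<Rightarrow> ennreal" where
  "curve_length \<gamma> a b =
    (SUP (n, t) \<in> {(n::nat, t). mono_on {..n} t \<and> t 0 = a \<and> t n = b}.
      \<Sum>i<n. ennreal (dist (\<gamma> (t i)) (\<gamma> (t (Suc i)))))"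

text \<open>
  A curve \<open>[0, l] \<rightarrow> P\<close> parametrized by arc length; it is rectifiable since its length is \<open>l\<close>, and
  non-constant since \<open>l > 0\<close>.
\<close>

definition arc_length_curve :: "real \<Rightarrow> (real \<Rightarrow> 'a::metric_space) \<Rightarrow> bool" where
  "arc_length_curve l \<gamma> \<longleftrightarrow>
    0 < l \<and> continuous_on {0..l} \<gamma> \<and> (\<forall>t\<in>{0..l}. curve_length \<gamma> 0 t = ennreal t)"

text \<open>
  Here \<open>\<bar>(\<plusminus>\<infinity>) - (\<plusminus>\<infinity>)\<bar> = \<infinity>\<close> is required, which is what subtraction on \<^typ>\<open>ereal\<close> gives,
  so \<^const>\<open>ext_diff\<close> is not used.
\<close>

definition upper_gradient :: "('a::metric_space \<Rightarrow> ereal) \<Rightarrow> ('a \<Rightarrow> ennreal) \<Rightarrow> bool" where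
  "upper_gradient u g \<longleftrightarrow>
    g \<in> borel_measurable borel \<and>
    (\<forall>l \<gamma>. arc_length_curve l \<gamma> \<longrightarrow>
      e2ennreal \<bar>u (\<gamma> 0) - u (\<gamma> l)\<bar> \<le> (\<integral>\<^sup>+ t\<in>{0..l}. g (\<gamma> t) \<partial>lborel))"

definition newtonian_norm ::
    "(('a::metric_space \<Rightarrow> ereal) \<Rightarrow> ennreal) \<Rightarrow> ('a \<Rightarrow> ereal) \<Rightarrow> ennreal" where
  "newtonian_norm N u = N u + (INF g \<in> {g. upper_gradient u g}. N (\<lambda>x. enn2ereal (g x)))"

definition newtonian_space ::
    "'a::metric_space measure \<Rightarrow> (('a \<Rightarrow> ereal) \<Rightarrow> ennreal) \<Rightarrow> ('a \<Rightarrow> ereal) set" where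
  "newtonian_space M N = {u \<in> borel_measurable M. newtonian_norm N u < \<infinity>}"

definition sobolev_capacity ::
    "'a::metric_space measure \<Rightarrow> (('a \<Rightarrow> ereal) \<Rightarrow> ennreal) \<Rightarrow> 'a set \<Rightarrow> ennreal" where
  "sobolev_capacity M N E =
    (INF u \<in> {u \<in> borel_measurable M. \<forall>x\<in>E. 1 \<le> u x}. newtonian_norm N u)"

definition quasi_everywhere ::
    "'a::metric_space measure \<Rightarrow> (('a \<Rightarrow> ereal) \<Rightarrow> ennreal) \<Rightarrow> ('a \<Rightarrow> bool) \<Rightarrow> bool" where
  "quasi_everywhere M N P \<longleftrightarrow> sobolev_capacity M N {x. \<not> P x} = 0"

text \<open>
  Uniform convergence of extended real-valued functions. By the convention on differences,
  \<open>\<bar>ext_diff a b\<bar> < \<epsilon>\<close> holds iff \<open>a = b\<close> or \<open>a\<close>, \<open>b\<close> are both finite and at distance less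
  than \<open>\<epsilon>\<close>; in particular, it implies pointwise convergence.
\<close>

definition converges_uniformly_on ::
    "'a set \<Rightarrow> (nat \<Rightarrow> 'a \<Rightarrow> ereal) \<Rightarrow> ('a \<Rightarrow> ereal) \<Rightarrow> bool" where
  "converges_uniformly_on S f h \<longleftrightarrow>
    (\<forall>\<epsilon>::real. 0 < \<epsilon> \<longrightarrow>
      (\<forall>\<^sub>F j in sequentially. \<forall>x\<in>S. \<bar>ext_diff (f j x) (h x)\<bar> < ereal \<epsilon>))"

end

theory Submission imports Defs
begin

text \<open>
  Pass to a subsequence along which the Newtonian norm of \<open>w k = u\<^sub>k - u\<close> is less than
  \<open>1 / (c^(k+1) 4^k)\<close>, and let \<open>E m\<close> be the set where \<open>2^k \<bar>w k\<bar> \<ge> 1\<close> for some \<open>k \<ge> m\<close>.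
  The function \<open>sup (min 1 (2^k \<bar>w k\<bar>))\<close>, the supremum being over \<open>k \<ge> m\<close>, is at least 1 on
  \<open>E m\<close> and has the upper gradient \<open>\<Sum> 2^k g k\<close>, where \<open>g k\<close> is an upper gradient of \<open>w k\<close>;
  by the Riesz--Fischer property the capacity of \<open>E m\<close> is at most \<open>2 / 2^m\<close>, and the
  convergence is uniform outside \<open>E m\<close>. If the \<open>u\<^sub>k\<close> are continuous, the set \<open>G\<close> where
  \<open>\<bar>u\<^sub>k\<^sub>+\<^sub>1 - u\<^sub>k\<bar> > 2 / 2^k\<close> for some \<open>k \<ge> m\<close> is open and contained in \<open>E m\<close>, and
  \<open>(u\<^sub>k)\<close> is uniformly Cauchy outside \<open>G\<close>.
\<close>

section \<open>Extended real arithmetic and the two conventions for differences of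
  infinities\<close>

lemma abs_ereal_mult: "\<bar>x * y\<bar> = \<bar>x\<bar> * \<bar>y :: ereal\<bar>"
  by (cases x; cases y) (auto simp: abs_mult)

lemma abs_ereal_minus_commute: "\<bar>x - y\<bar> = \<bar>y - x :: ereal\<bar>"
  by (cases x; cases y) auto

text \<open>At infinite \<open>x\<close> or \<open>y\<close> the library difference
  \<open>x - y\<close> is infinite in absolute value, so the bound is trivial; at finite values it
  is the triangle inequality cut off at 1.\<close>

lemma truncation_le_add:
  assumes "0 < b"
  shows "min 1 (ereal b * \<bar>x\<bar>) \<le> min 1 (ereal b * \<bar>y\<bar>) + ereal b * \<bar>x - y\<bar>"
proof (cases "\<bar>x\<bar> = \<infinity> \<or> \<bar>y\<bar> = \<infinity>")
  case True
  then have "\<bar>x - y\<bar> = \<infinity>" by (cases x; cases y) auto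
  then show ?thesis using assms by (cases "ereal b * \<bar>y\<bar>") (auto simp: min_def)
next
  case False
  then obtain p q where pq: "x = ereal p" "y = ereal q" by (cases x; cases y) auto
  have "b * \<bar>p\<bar> \<le> b * (\<bar>q\<bar> + \<bar>p - q\<bar>)" using assms by (intro mult_left_mono) auto
  then have "b * \<bar>p\<bar> \<le> b * \<bar>q\<bar> + b * \<bar>p - q\<bar>" by (simp add: distrib_left)
  moreover have "0 \<le> b * \<bar>p - q\<bar>" using assms by auto
  ultimately have "min 1 (b * \<bar>p\<bar>) \<le> min 1 (b * \<bar>q\<bar>) + b * \<bar>p - q\<bar>" by linarith
  moreover have "min 1 (ereal s) = ereal (min 1 s)" for s
    by (simp add: one_ereal_def)
  ultimately show ?thesis
    by (simp only: pq abs_ereal.simps ereal_minus times_ereal.simps plus_ereal.simps ereal_less_eq)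
qed

text \<open>If \<open>a\<close> or \<open>b\<close> is infinite, both sides hold exactly when
  \<open>a = b\<close>. The form without subtraction suits closedness, telescoping and limsup
  arguments.\<close>

lemma abs_ext_diff_le_iff:
  "\<bar>ext_diff a b\<bar> \<le> ereal e \<longleftrightarrow> a \<le> b + ereal e \<and> b \<le> a + ereal e" if "0 \<le> e"
  using that by (cases a; cases b) (auto simp: ext_diff_def ext_add_def)

text \<open>For \<open>ext_diff\<close>, an infinite value has distance 0 from itself and infinite
  distance from every other value, so the triangle inequality survives.\<close>

lemma abs_ext_diff_triangle:
  "\<bar>ext_diff a b\<bar> \<le> \<bar>ext_diff a z\<bar> + \<bar>ext_diff b z\<bar>"
  by (cases a; cases b; cases z) (auto simp: ext_diff_def ext_add_def)

lemma tendsto_if_abs_ext_diff_small: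
  assumes small: "\<And>e. 0 < e \<Longrightarrow> \<forall>\<^sub>F j in sequentially. \<bar>ext_diff (f j) a\<bar> < ereal e"
  shows "f \<longlonglongrightarrow> a"
proof (cases "\<bar>a\<bar> = \<infinity>")
  case True
  \<comment> \<open>No value other than \<open>a\<close> lies at finite distance from an infinite
    \<open>a\<close>.\<close>
  have "f j = a" if "\<bar>ext_diff (f j) a\<bar> < ereal 1" for j
    using that True by (cases a; cases "f j") (auto simp: ext_diff_def ext_add_def)
  then have "\<forall>\<^sub>F j in sequentially. f j = a"
    using small[of 1] by (auto elim: eventually_mono)
  then show ?thesis by (rule tendsto_eventually)
next
  case False
  then obtain r where a: "a = ereal r" by auto
  have between: "ereal (r - e) < f j \<and> f j < ereal (r + e)" if "\<bar>ext_diff (f j) a\<bar> < ereal e" for j e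
    using that a by (cases "f j") (auto simp: ext_diff_def ext_add_def)
  show ?thesis
  proof (rule order_tendstoI)
    fix b assume "b < a"
    then obtain z where z: "b < ereal z" "z < r" using ereal_dense2[of b a] a by auto
    show "\<forall>\<^sub>F j in sequentially. b < f j"
      using small[of "r - z"] z
      by (auto elim!: eventually_mono dest!: between less_trans[OF z(1)])
  next
    fix b assume "a < b"
    then obtain z where z: "ereal z < b" "r < z" using ereal_dense2[of a b] a by auto
    show "\<forall>\<^sub>F j in sequentially. f j < b"
      using small[of "z - r"] z
      by (auto elim!: eventually_mono dest!: between intro: less_trans[OF _ z(1)])
  qed
qed

section \<open>Open superlevel sets and uniform Cauchy sequences\<close>

text \<open>Since \<open>ext_diff\<close> is discontinuous at pairs of equal infinities, the
  complement is written as two inequalities between continuous functions.\<close>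

lemma open_Collect_abs_ext_diff_greater:
  assumes "continuous_on UNIV f" "continuous_on UNIV g" "0 \<le> e"
  shows "open {x. ereal e < \<bar>ext_diff (f x) (g x)\<bar>}"
proof -
  have cont: "continuous_on UNIV (\<lambda>x. h x + ereal e)" if "continuous_on UNIV h" for h :: "'a \<Rightarrow> ereal"
    using that unfolding continuous_on_def by (auto intro!: tendsto_add_ereal_general1)
  have "closed {x. f x \<le> g x + ereal e \<and> g x \<le> f x + ereal e}"
    using assms by (intro closed_Collect_conj closed_Collect_le cont)
  also have "{x. f x \<le> g x + ereal e \<and> g x \<le> f x + ereal e} = - {x. ereal e < \<bar>ext_diff (f x) (g x)\<bar>}"
    unfolding abs_ext_diff_le_iff[OF assms(3), symmetric] by auto
  finally show ?thesis by (simp add: closed_def)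
qed

lemma eventually_mult_half_power_less:
  assumes "0 < e"
  shows "\<forall>\<^sub>F k in sequentially. C * (1 / 2 :: real) ^ k < e"
proof -
  have "(\<lambda>k. C * (1 / 2 :: real) ^ k) \<longlonglongrightarrow> C * 0"
    by (intro tendsto_mult_left LIMSEQ_realpow_zero) auto
  then show ?thesis using assms by (intro order_tendstoD(2)) auto
qed

text \<open>The steps sum to a geometric tail, so the sequence is uniformly Cauchy on
  \<open>S\<close>; the limsup provides a limit that also makes sense at infinite values.\<close>

lemma converges_uniformly_on_limsup:
  assumes step: "\<And>x k. x \<in> S \<Longrightarrow> m \<le> k \<Longrightarrow>
    \<bar>ext_diff (f (Suc k) x) (f k x)\<bar> \<le> ereal (2 * (1 / 2) ^ k)"
  shows "converges_uniformly_on S f (\<lambda>x. limsup (\<lambda>j. f j x))"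
proof -
  have tail: "f j x \<le> f k x + ereal (4 * (1 / 2) ^ k) \<and> f k x \<le> f j x + ereal (4 * (1 / 2) ^ k)"
    if x: "x \<in> S" and k: "m \<le> k" "k \<le> j" for x j k
  proof -
    \<comment> \<open>The difference is the exact sum of \<open>2 * (1 / 2) ^ i\<close> over
      \<open>k \<le> i < j\<close>, which makes the induction close.\<close>
    have "f j x \<le> f k x + ereal (4 * (1 / 2) ^ k - 4 * (1 / 2) ^ j) \<and>
        f k x \<le> f j x + ereal (4 * (1 / 2) ^ k - 4 * (1 / 2) ^ j)"
      using k(2)
    proof (induction j rule: dec_induct)
      case base
      show ?case by (simp add: zero_ereal_def[symmetric])
    next
      case (step j)
      have "f (Suc j) x \<le> f j x + ereal (2 * (1 / 2) ^ j)" "f j x \<le> f (Suc j) x + ereal (2 * (1 / 2) ^ j)"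
        using assms[OF x, of j] k(1) step(1)
        by (auto simp: abs_ext_diff_le_iff)
      with step(3) show ?case
        by (cases "f j x"; cases "f (Suc j) x"; cases "f k x") auto
    qed
    then show ?thesis by (cases "f j x"; cases "f k x") (auto intro: order_trans)
  qed
  have lim: "\<bar>ext_diff (f k x) (limsup (\<lambda>j. f j x))\<bar> \<le> ereal (4 * (1 / 2) ^ k)"
    if "x \<in> S" "m \<le> k" for x k
  proof -
    have "limsup (\<lambda>j. f j x) \<le> f k x + ereal (4 * (1 / 2) ^ k)"
      using tail[OF that] by (intro Limsup_bounded) (auto simp: eventually_sequentially)
    moreover have "f k x - ereal (4 * (1 / 2) ^ k) \<le> limsup (\<lambda>j. f j x)"
    proof (rule order_trans[OF Liminf_bounded Liminf_le_Limsup])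
      show "\<forall>\<^sub>F j in sequentially. f k x - ereal (4 * (1 / 2) ^ k) \<le> f j x"
        unfolding eventually_sequentially
        using tail[OF that] by (intro exI[of _ k]) (auto simp: ereal_minus_le_iff add.commute)
    qed simp
    ultimately show ?thesis
      by (simp add: abs_ext_diff_le_iff ereal_minus_le_iff add.commute)
  qed
  show ?thesis
    unfolding converges_uniformly_on_def
  proof (intro allI impI)
    fix e :: real assume "0 < e"
    show "\<forall>\<^sub>F k in sequentially. \<forall>x\<in>S. \<bar>ext_diff (f k x) (limsup (\<lambda>j. f j x))\<bar> < ereal e"
      using eventually_mult_half_power_less[OF \<open>0 < e\<close>] eventually_ge_at_top[of m]
      by eventually_elim (auto intro: le_less_trans[OF lim])
  qed
qed

section \<open>Measurability and upper gradients\<close>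

lemma measurable_ext_diff:
  assumes "f \<in> borel_measurable M" "g \<in> borel_measurable M"
  shows "(\<lambda>x. ext_diff (f x) (g x)) \<in> borel_measurable M"
  using assms unfolding ext_diff_def ext_add_def by measurable

text \<open>
  Truncating at 1 keeps the supremum finite; without it, the supremum could be infinite at both
  ends of a curve, where the inequality would require the gradient to have infinite integral.
\<close>

lemma upper_gradient_SUP_truncation:
  fixes w :: "nat \<Rightarrow> 'a::metric_space \<Rightarrow> ereal"
  assumes ug: "\<And>k. upper_gradient (w k) (g k)" and b: "\<And>k. 0 < b k"
  shows "upper_gradient (\<lambda>x. SUP k. min 1 (ereal (b k) * \<bar>w k x\<bar>))
           (\<lambda>x. \<Sum>k. ennreal (b k) * g k x)"
  unfolding upper_gradient_def
proof (intro conjI allI impI)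
  have [measurable]: "g k \<in> borel_measurable borel" for k
    using ug by (simp add: upper_gradient_def)
  show "(\<lambda>x. \<Sum>k. ennreal (b k) * g k x) \<in> borel_measurable borel"
    by measurable
  fix l and \<gamma> :: "real \<Rightarrow> 'a"
  assume \<gamma>: "arc_length_curve l \<gamma>"
  let ?S = "\<lambda>x. SUP k. min 1 (ereal (b k) * \<bar>w k x\<bar>)"
  let ?I = "\<integral>\<^sup>+ t\<in>{0..l}. (\<Sum>k. ennreal (b k) * g k (\<gamma> t)) \<partial>lborel"
  \<comment> \<open>Nothing is known about \<open>\<gamma>\<close> outside \<open>{0..l}\<close>, so
    measurability is obtained on the restricted space first.\<close>
  have \<gamma>_meas: "\<gamma> \<in> borel_measurable (restrict_space lborel {0..l})"
    using \<gamma> borel_measurable_continuous_on_restrict[of "{0..l}" \<gamma>]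
    by (simp add: arc_length_curve_def measurable_def space_restrict_space sets_restrict_space)
  have g_meas: "(\<lambda>t. g k (\<gamma> t) * indicator {0..l} t) \<in> borel_measurable lborel" for k
    using measurable_compose[OF \<gamma>_meas, of "g k" borel]
    by (subst borel_measurable_restrict_space_iff_ennreal[symmetric]) auto
  have diff: "ereal (b k) * \<bar>w k (\<gamma> 0) - w k (\<gamma> l)\<bar> \<le> enn2ereal ?I" for k
  proof -
    have "ennreal (b k) * e2ennreal \<bar>w k (\<gamma> 0) - w k (\<gamma> l)\<bar>
        \<le> ennreal (b k) * (\<integral>\<^sup>+ t\<in>{0..l}. g k (\<gamma> t) \<partial>lborel)"
      using ug \<gamma> by (intro mult_left_mono) (auto simp: upper_gradient_def)
    also have "\<dots> = (\<integral>\<^sup>+ t. ennreal (b k) * (g k (\<gamma> t) * indicator {0..l} t) \<partial>lborel)"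
      using g_meas by (simp add: nn_integral_cmult)
    also have "\<dots> \<le> ?I"
    proof (rule nn_integral_mono)
      fix t
      have "ennreal (b k) * g k (\<gamma> t) \<le> (\<Sum>k. ennreal (b k) * g k (\<gamma> t))"
        using sum_le_suminf[of "\<lambda>k. ennreal (b k) * g k (\<gamma> t)" "{k}"] by auto
      then show "ennreal (b k) * (g k (\<gamma> t) * indicator {0..l} t)
          \<le> (\<Sum>k. ennreal (b k) * g k (\<gamma> t)) * indicator {0..l} t"
        by (auto simp: indicator_def)
    qed
    finally have "enn2ereal (ennreal (b k) * e2ennreal \<bar>w k (\<gamma> 0) - w k (\<gamma> l)\<bar>) \<le> enn2ereal ?I"
      by (simp add: less_eq_ennreal.rep_eq)
    then show ?thesis
      using b[of k] by (simp add: times_ennreal.rep_eq enn2ereal_ennreal enn2ereal_e2ennreal)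
  qed
  \<comment> \<open>One bound serves all \<open>k\<close>, hence it passes to the supremum.\<close>
  have le: "?S x \<le> ?S y + enn2ereal ?I"
    if "\<And>k. ereal (b k) * \<bar>w k x - w k y\<bar> \<le> enn2ereal ?I" for x y
  proof (rule SUP_least)
    fix k
    have "min 1 (ereal (b k) * \<bar>w k x\<bar>)
        \<le> min 1 (ereal (b k) * \<bar>w k y\<bar>) + ereal (b k) * \<bar>w k x - w k y\<bar>"
      by (rule truncation_le_add[OF b])
    also have "\<dots> \<le> ?S y + enn2ereal ?I"
      by (intro add_mono SUP_upper that) auto
    finally show "min 1 (ereal (b k) * \<bar>w k x\<bar>) \<le> ?S y + enn2ereal ?I" .
  qed
  \<comment> \<open>The end values are thus finite, and the two one-sided estimates combine into a
    bound on the absolute difference.\<close>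
  have bounds: "0 \<le> ?S x \<and> ?S x \<le> 1" for x
    using b by (auto intro!: SUP_least SUP_upper2[of 0] simp: less_imp_le)
  have "\<bar>?S (\<gamma> 0) - ?S (\<gamma> l)\<bar> \<le> enn2ereal ?I"
  proof -
    have 1: "?S (\<gamma> 0) \<le> ?S (\<gamma> l) + enn2ereal ?I"
      by (rule le[OF diff])
    have 2: "?S (\<gamma> l) \<le> ?S (\<gamma> 0) + enn2ereal ?I"
      by (rule le) (subst abs_ereal_minus_commute, rule diff)
    obtain p q where "?S (\<gamma> 0) = ereal p" "?S (\<gamma> l) = ereal q"
      using bounds[of "\<gamma> 0"] bounds[of "\<gamma> l"]
      by (cases "?S (\<gamma> 0)"; cases "?S (\<gamma> l)") auto
    with 1 2 show ?thesis by (cases "enn2ereal ?I") auto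
  qed
  then show "e2ennreal \<bar>?S (\<gamma> 0) - ?S (\<gamma> l)\<bar> \<le> ?I"
    using e2ennreal_mono by fastforce
qed

lemma sobolev_capacity_mono:
  "A \<subseteq> B \<Longrightarrow> sobolev_capacity M N A \<le> sobolev_capacity M N B"
  unfolding sobolev_capacity_def by (rule INF_superset_mono) auto

section \<open>Capacity estimate from the Riesz--Fischer property\<close>

context quasi_Banach_function_lattice
begin

lemma borel_measurable_imp_measurable: "f \<in> borel_measurable borel \<Longrightarrow> f \<in> borel_measurable M"
  using borel_subset by (auto simp: measurable_def space_eq_UNIV)

text \<open>Serves both functions and gradients; \<open>s\<close> is a separate parameter because
  the gradients are summed in \<open>ennreal\<close> and only then embedded into
  \<open>ereal\<close>.\<close>

lemma norm_suminf_scaled_le: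
  assumes "\<And>n. f n \<in> borel_measurable M" "\<And>n. 0 < b n" "s \<in> borel_measurable M"
    and "\<And>x. (\<lambda>n. ereal (b n) * \<bar>f n x\<bar>) sums s x"
  shows "N s \<le> (\<Sum>n. ennreal (c ^ Suc n * b n) * N (f n))"
proof -
  note [measurable] = assms(1)
  have "N s \<le> (\<Sum>n. ennreal (c ^ Suc n) * N (\<lambda>x. ereal (b n) * \<bar>f n x\<bar>))"
    using assms by (intro riesz_fischer) (auto simp: less_imp_le)
  also have "\<dots> \<le> (\<Sum>n. ennreal (c ^ Suc n * b n) * N (f n))"
  proof (rule suminf_le)
    fix n
    have "N (\<lambda>x. ereal (b n) * \<bar>f n x\<bar>) \<le> N (\<lambda>x. ereal (b n) * f n x)"
      by (intro norm_mono) (auto simp: abs_ereal_mult)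
    also have "\<dots> = ennreal (b n) * N (f n)"
      using assms norm_scale[of "f n" "b n"] by (simp add: less_imp_le)
    finally show "ennreal (c ^ Suc n) * N (\<lambda>x. ereal (b n) * \<bar>f n x\<bar>)
        \<le> ennreal (c ^ Suc n * b n) * N (f n)"
      using assms(2)[of n] modulus_ge_1
      by (simp add: ennreal_mult less_imp_le mult.assoc mult_left_mono del: power_Suc)
  qed auto
  finally show ?thesis .
qed

lemma capacity_superlevel_sets_le:
  assumes meas: "\<And>n. w n \<in> borel_measurable M" and b: "\<And>n. 0 < b n"
    and small: "\<And>n. newtonian_norm N (w n) < \<delta> n"
  shows "sobolev_capacity M N {x. \<exists>n. 1 \<le> ereal (b n) * \<bar>w n x\<bar>}
    \<le> (\<Sum>n. ennreal (c ^ Suc n * b n) * \<delta> n)"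
proof -
  note [measurable] = meas
  have "\<exists>g. upper_gradient (w n) g \<and> N (w n) + N (\<lambda>x. enn2ereal (g x)) \<le> \<delta> n" for n
  proof -
    let ?I = "INF g \<in> {g. upper_gradient (w n) g}. N (\<lambda>x. enn2ereal (g x))"
    have less: "N (w n) + ?I < \<delta> n"
      using small[of n] by (simp add: newtonian_norm_def)
    \<comment> \<open>Finiteness permits moving \<open>N (w n)\<close> across the strict inequality,
      leaving room to choose a gradient.\<close>
    then have fin: "N (w n) < top"
      by (meson le_iff_add le_less_trans less_le_trans top_greatest)
    then have "?I < \<delta> n - N (w n)"
      using less by (simp add: less_diff_eq_ennreal add.commute)
    then obtain g where "upper_gradient (w n) g" "N (\<lambda>x. enn2ereal (g x)) < \<delta> n - N (w n)"
      by (auto simp: INF_less_iff)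
    then show ?thesis
      using fin by (auto simp: less_diff_eq_ennreal add.commute intro!: exI[of _ g] less_imp_le)
  qed
  then obtain g where ug: "\<And>n. upper_gradient (w n) (g n)"
    and g: "\<And>n. N (w n) + N (\<lambda>x. enn2ereal (g n x)) \<le> \<delta> n" by metis
  let ?S = "\<lambda>x. SUP k. min 1 (ereal (b k) * \<bar>w k x\<bar>)"
  let ?T = "\<lambda>x. \<Sum>n. ereal (b n) * \<bar>w n x\<bar>"
  let ?g = "\<lambda>x. \<Sum>n. ennreal (b n) * g n x"
  have g_meas [measurable]: "g n \<in> borel_measurable borel" "g n \<in> borel_measurable M" for n
    using ug borel_measurable_imp_measurable by (auto simp: upper_gradient_def)
  have nonneg: "0 \<le> ereal (b n) * \<bar>w n x\<bar>" for n x
    using b by (simp add: less_imp_le)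
  have "?S x \<le> ?T x" for x
  proof (rule SUP_least)
    fix k
    have "ereal (b k) * \<bar>w k x\<bar> \<le> ?T x"
      using sum_le_suminf[of "\<lambda>n. ereal (b n) * \<bar>w n x\<bar>" "{k}"] nonneg
      by (auto intro: summable_ereal_pos)
    then show "min 1 (ereal (b k) * \<bar>w k x\<bar>) \<le> ?T x" by (simp add: min.coboundedI2)
  qed
  moreover have "0 \<le> ?S x" for x
    using nonneg by (intro SUP_upper2[of 0]) auto
  ultimately have "\<bar>?S x\<bar> \<le> \<bar>?T x\<bar>" for x
    using order_trans[of 0 "?S x" "?T x"] by simp
  then have "N ?S \<le> N ?T"
    by (intro norm_mono AE_I2) auto
  also have "\<dots> \<le> (\<Sum>n. ennreal (c ^ Suc n * b n) * N (w n))"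
    using nonneg b by (intro norm_suminf_scaled_le summable_sums summable_ereal_pos) auto
  finally have S: "N ?S \<le> \<dots>" .
  have G: "N (\<lambda>x. enn2ereal (?g x)) \<le> (\<Sum>n. ennreal (c ^ Suc n * b n) * N (\<lambda>x. enn2ereal (g n x)))"
  proof (rule norm_suminf_scaled_le)
    fix x
    have "(\<lambda>n. enn2ereal (ennreal (b n) * g n x)) sums enn2ereal (?g x)"
      by (simp add: summable_sums)
    then show "(\<lambda>n. ereal (b n) * \<bar>enn2ereal (g n x)\<bar>) sums enn2ereal (?g x)"
      using b by (simp add: times_ennreal.rep_eq enn2ereal_ennreal less_imp_le)
  qed (use b in auto)
  have "sobolev_capacity M N {x. \<exists>n. 1 \<le> ereal (b n) * \<bar>w n x\<bar>} \<le> newtonian_norm N ?S"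
    unfolding sobolev_capacity_def
  proof (rule INF_lower, safe)
    fix x n assume "1 \<le> ereal (b n) * \<bar>w n x\<bar>"
    then show "1 \<le> ?S x" by (intro SUP_upper2[of n]) auto
  qed measurable
  also have "\<dots> \<le> N ?S + N (\<lambda>x. enn2ereal (?g x))"
    unfolding newtonian_norm_def
    using upper_gradient_SUP_truncation[OF ug b] by (intro add_left_mono INF_lower) auto
  also have "\<dots> \<le> (\<Sum>n. ennreal (c ^ Suc n * b n) * N (w n))
      + (\<Sum>n. ennreal (c ^ Suc n * b n) * N (\<lambda>x. enn2ereal (g n x)))"
    by (rule add_mono[OF S G])
  \<comment> \<open>Both series carry the same weights, so function and gradient norms recombine
    termwise and are bounded by \<open>\<delta> n\<close>.\<close>
  also have "\<dots> = (\<Sum>n. ennreal (c ^ Suc n * b n) * (N (w n) + N (\<lambda>x. enn2ereal (g n x))))"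
    by (subst suminf_add) (auto simp: distrib_left)
  also have "\<dots> \<le> (\<Sum>n. ennreal (c ^ Suc n * b n) * \<delta> n)"
    using g by (intro suminf_le mult_left_mono) auto
  finally show ?thesis .
qed

end

section \<open>Choice of the subsequence and conclusion\<close>

lemma strict_mono_choice_of_eventually:
  assumes "\<And>k. \<forall>\<^sub>F j in sequentially. P k j"
  obtains r :: "nat \<Rightarrow> nat" where "strict_mono r" "\<And>k. P k (r k)"
proof -
  from assms obtain J where J: "\<And>k j. J k \<le> j \<Longrightarrow> P k j"
    unfolding eventually_sequentially by metis
  have "\<exists>r. \<forall>k. J k \<le> r k \<and> r k < r (Suc k)"
  proof (rule dependent_nat_choice)
    show "\<exists>y. J (Suc n) \<le> y \<and> x < y" for x n
      by (intro exI[of _ "max (J (Suc n)) (Suc x)"]) auto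
  qed auto
  then obtain r where r: "\<And>k. J k \<le> r k" "\<And>k. r k < r (Suc k)" by blast
  show ?thesis
    by (rule that[of r]) (use r J in \<open>auto simp: strict_mono_Suc_iff\<close>)
qed

theorem corollary7p2:
  fixes M :: "'a::metric_space measure"
    and c :: real
    and N :: "('a \<Rightarrow> ereal) \<Rightarrow> ennreal"
    and u :: "'a \<Rightarrow> ereal"
    and us :: "nat \<Rightarrow> 'a \<Rightarrow> ereal"
  assumes "quasi_Banach_function_lattice M c N"
    and "\<And>j. us j \<in> newtonian_space M N"
    and "u \<in> newtonian_space M N"
    and "(\<lambda>j. newtonian_norm N (\<lambda>x. ext_diff (us j x) (u x))) \<longlonglongrightarrow> 0"
  shows "\<exists>r :: nat \<Rightarrow> nat. strict_mono r \<and>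
    quasi_everywhere M N (\<lambda>x. (\<lambda>j. us (r j) x) \<longlonglongrightarrow> u x) \<and>
    (\<forall>\<epsilon>::real. 0 < \<epsilon> \<longrightarrow>
      (\<exists>E. sobolev_capacity M N E < ennreal \<epsilon> \<and>
        converges_uniformly_on (- E) (\<lambda>j. us (r j)) u)) \<and>
    ((\<forall>j. continuous_on UNIV (us j)) \<longrightarrow>
      (\<forall>\<epsilon>::real. 0 < \<epsilon> \<longrightarrow>
        (\<exists>G. open G \<and> sobolev_capacity M N G < ennreal \<epsilon> \<and>
          (\<exists>v. converges_uniformly_on (- G) (\<lambda>j. us (r j)) v))))"
proof -
  interpret quasi_Banach_function_lattice M c N by fact
  \<comment> \<open>\<open>c ^ Suc k\<close> absorbs the Riesz--Fischer weight; \<open>4 ^ k\<close>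
    beats the scaling \<open>2 ^ k\<close> and leaves a summable \<open>(1 / 2) ^ k\<close>.\<close>
  define \<delta> where "\<delta> k = ennreal (1 / (c ^ Suc k * 4 ^ k))" for k
  have \<delta>_pos: "0 < \<delta> k" for k
    using modulus_ge_1 by (simp add: \<delta>_def)
  obtain r where r: "strict_mono r"
    and fast: "\<And>k. newtonian_norm N (\<lambda>x. ext_diff (us (r k) x) (u x)) < \<delta> k"
    using strict_mono_choice_of_eventually[of "\<lambda>k j. newtonian_norm N (\<lambda>x. ext_diff (us j x) (u x)) < \<delta> k"]
      order_tendstoD(2)[OF assms(4) \<delta>_pos] by metis
  define f where "f k = us (r k)" for k
  define w where "w k x = ext_diff (f k x) (u x)" for k x
  have w_meas: "w k \<in> borel_measurable M" for k
    using assms(2,3) unfolding w_def f_def newtonian_space_def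
    by (auto intro: measurable_ext_diff)
  \<comment> \<open>The shift by \<open>m\<close> lets the capacity estimate, whose series starts at
    0, apply to the tail.\<close>
  define E where "E m = {x. \<exists>n. 1 \<le> ereal (2 ^ (m + n)) * \<bar>w (m + n) x\<bar>}" for m
  have capE: "sobolev_capacity M N (E m) \<le> ennreal (2 * (1 / 2) ^ m)" for m
  proof -
    have "sobolev_capacity M N (E m) \<le> (\<Sum>n. ennreal (c ^ Suc n * 2 ^ (m + n)) * \<delta> (m + n))"
      unfolding E_def using fast w_meas
      by (intro capacity_superlevel_sets_le) (auto simp: w_def[abs_def] f_def)
    also have "\<dots> \<le> (\<Sum>n. ennreal ((1 / 2) ^ m * (1 / 2) ^ n))"
    proof (rule suminf_le)
      fix n
      \<comment> \<open>The weights restart at \<open>c ^ Suc n\<close> while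
        \<open>\<delta>\<close> contains \<open>c ^ Suc (m + n)\<close>; since
        \<open>1 \<le> c\<close>, the quotient is at most 1.\<close>
      have c: "0 < c" "c ^ Suc n \<le> c ^ Suc (m + n)"
        using modulus_ge_1 by (auto intro!: power_increasing simp del: power_Suc)
      have four: "4 ^ k = 2 ^ k * (2 ^ k :: real)" for k
        by (simp flip: power_mult_distrib)
      have "c ^ Suc n * 2 ^ (m + n) * (1 / (c ^ Suc (m + n) * 4 ^ (m + n)))
          = c ^ Suc n / c ^ Suc (m + n) * (1 / 2) ^ (m + n)"
        using c(1) by (simp add: power_divide four del: power_Suc)
      also have "\<dots> \<le> 1 * (1 / 2) ^ (m + n)"
        using c by (intro mult_right_mono) (auto simp del: power_Suc)
      finally have "c ^ Suc n * 2 ^ (m + n) * (1 / (c ^ Suc (m + n) * 4 ^ (m + n)))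
          \<le> (1 / 2) ^ m * (1 / 2) ^ n"
        by (simp only: power_add mult_1)
      then show "ennreal (c ^ Suc n * 2 ^ (m + n)) * \<delta> (m + n) \<le> ennreal ((1 / 2) ^ m * (1 / 2) ^ n)"
        unfolding \<delta>_def using c(1)
        by (subst ennreal_mult[symmetric]) (auto intro!: ennreal_leI simp del: power_Suc)
    qed auto
    also have "\<dots> = ennreal (2 * (1 / 2) ^ m)"
    proof (rule suminf_ennreal_eq)
      show "(\<lambda>n. (1 / 2) ^ m * (1 / 2) ^ n) sums (2 * (1 / 2 :: real) ^ m)"
        using sums_mult[OF geometric_sums[of "1 / 2 :: real"], of "(1 / 2) ^ m"] by (simp add: mult.commute)
    qed auto
    finally show ?thesis .
  qed
  have capE_small: "\<exists>m. sobolev_capacity M N (E m) < ennreal \<epsilon>" if \<epsilon>: "0 < \<epsilon>" for \<epsilon> :: real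
  proof -
    obtain m where "2 * (1 / 2) ^ m < \<epsilon>"
      using eventually_happens[OF eventually_mult_half_power_less[OF \<epsilon>, of 2]] by auto
    then show ?thesis
      using \<epsilon> by (intro exI[of _ m] le_less_trans[OF capE]) (simp add: ennreal_lessI)
  qed
  have w_small: "\<bar>w k x\<bar> < ereal ((1 / 2) ^ k)" if "x \<notin> E m" "m \<le> k" for x k m
  proof -
    obtain n where "k = m + n" using \<open>m \<le> k\<close> le_Suc_ex by blast
    with that have "ereal (2 ^ k) * \<bar>w k x\<bar> < 1" by (auto simp: E_def not_le)
    then show ?thesis
      by (cases "w k x") (auto simp: field_simps one_ereal_def)
  qed
  have unif: "converges_uniformly_on (- E m) f u" for m
    unfolding converges_uniformly_on_def
  proof (intro allI impI)
    fix \<epsilon> :: real assume "0 < \<epsilon>"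
    show "\<forall>\<^sub>F j in sequentially. \<forall>x\<in>- E m. \<bar>ext_diff (f j x) (u x)\<bar> < ereal \<epsilon>"
      using eventually_mult_half_power_less[OF \<open>0 < \<epsilon>\<close>, of 1] eventually_ge_at_top[of m]
    proof eventually_elim
      case (elim j)
      show ?case
      proof
        fix x assume "x \<in> - E m"
        then have "\<bar>w j x\<bar> < ereal ((1 / 2) ^ j)" using elim by (intro w_small) auto
        also have "\<dots> < ereal \<epsilon>" using elim(1) by simp
        finally show "\<bar>ext_diff (f j x) (u x)\<bar> < ereal \<epsilon>" by (simp add: w_def)
      qed
    qed
  qed
  have "sobolev_capacity M N {x. \<not> (\<lambda>j. f j x) \<longlonglongrightarrow> u x} = 0"
  proof -
    \<comment> \<open>The exceptional set lies in every \<open>E m\<close>, and these have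
      arbitrarily small capacity.\<close>
    have "{x. \<not> (\<lambda>j. f j x) \<longlonglongrightarrow> u x} \<subseteq> E m" for m
      using unif[of m] unfolding converges_uniformly_on_def
      by (auto intro!: tendsto_if_abs_ext_diff_small elim!: eventually_mono)
    then have "sobolev_capacity M N {x. \<not> (\<lambda>j. f j x) \<longlonglongrightarrow> u x} < ennreal \<epsilon>" if "0 < \<epsilon>" for \<epsilon>
      using capE_small[OF that] sobolev_capacity_mono le_less_trans by metis
    then have "sobolev_capacity M N {x. \<not> (\<lambda>j. f j x) \<longlonglongrightarrow> u x} \<le> 0"
      by - (rule ennreal_le_epsilon, simp add: less_imp_le)
    then show ?thesis by simp
  qed
  moreover have "\<exists>G. open G \<and> sobolev_capacity M N G < ennreal \<epsilon> \<and> (\<exists>v. converges_uniformly_on (- G) f v)"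
    if cont: "\<forall>j. continuous_on UNIV (us j)" and "0 < \<epsilon>" for \<epsilon> :: real
  proof -
    obtain m where m: "sobolev_capacity M N (E m) < ennreal \<epsilon>"
      using capE_small[OF \<open>0 < \<epsilon>\<close>] by blast
    \<comment> \<open>\<open>E m\<close> involves \<open>u\<close> and need not be open; consecutive
      differences involve only continuous functions. The threshold exceeds
      \<open>(1 / 2) ^ Suc k + (1 / 2) ^ k\<close>, which bounds them outside
      \<open>E m\<close>.\<close>
    define G where "G = (\<Union>k\<in>{m..}. {x. ereal (2 * (1 / 2) ^ k) < \<bar>ext_diff (f (Suc k) x) (f k x)\<bar>})"
    have "open G"
      unfolding G_def using cont by (intro open_UN ballI open_Collect_abs_ext_diff_greater) (auto simp: f_def)
    have "\<bar>ext_diff (f (Suc k) x) (f k x)\<bar> \<le> ereal (2 * (1 / 2) ^ k)" if "x \<notin> E m" "m \<le> k" for x k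
    proof -
      have "\<bar>ext_diff (f (Suc k) x) (f k x)\<bar> \<le> \<bar>w (Suc k) x\<bar> + \<bar>w k x\<bar>"
        unfolding w_def by (rule abs_ext_diff_triangle)
      also have "\<dots> \<le> ereal ((1 / 2) ^ Suc k) + ereal ((1 / 2) ^ k)"
        using w_small[of x m "Suc k"] w_small[of x m k] that
        by (intro add_mono) (auto intro: less_imp_le)
      also have "\<dots> \<le> ereal (2 * (1 / 2) ^ k)" by simp
      finally show ?thesis .
    qed
    then have "G \<subseteq> E m" by (force simp: G_def not_less[symmetric])
    then have "sobolev_capacity M N G < ennreal \<epsilon>"
      using m sobolev_capacity_mono le_less_trans by metis
    \<comment> \<open>The limit may differ from \<open>u\<close> on the part of \<open>E m\<close>
      outside \<open>G\<close>.\<close>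
    moreover have "converges_uniformly_on (- G) f (\<lambda>x. limsup (\<lambda>j. f j x))"
      by (rule converges_uniformly_on_limsup[of _ m]) (auto simp: G_def not_less)
    ultimately show ?thesis using \<open>open G\<close> by blast
  qed
  ultimately show ?thesis
    using r unif capE_small unfolding f_def quasi_everywhere_def
    by (intro exI[of _ r] conjI allI impI) blast+
qed

end
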